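(* For every integer $k\ge 2$, the bipartite graph $D_k$ is an ACB graph with $\nabla_{D_k}(X)=\nabla_{D_k}(Y)=k$.
   Context: For $k\ge2$, $D_k=(X,Y,E)$ is the bipartite graph with $X=\{x_1,\dots,x_{3k-4}\}$, $Y=\{y_1,\dots,y_{3k-4}\}$, where $x_iy_j$ is an edge iff $|i-j|\le k-2$ and $\{i,j\}\cap\{k-1,\dots,2k-2\}\neq\emptyset$. For a bipartite graph $B=(X,Y,E)$ with color classes $X,Y$: the mirror $mir(B)$ has the same color classes and $xy$ ($x\in X$, $y\in Y$) is an edge iff it is not an edge of $B$; $B$ is chordal bipartite if it has no induced chordless cycle $C_{2k}$, $k\ge3$; $B$ is ACB if both $B$ and $mir(B)$ are chordal bipartite. $\nabla_B(X)$ is the maximum number of vertices of $X$ whose neighborhoods $N(x)$ are pairwise incomparable with respect to set inclusion (two equal neighborhoods count as comparable); $\nabla_B(Y)$ is defined analogously. *)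

theory Defs
  imports Main
begin

(* The color classes are kept disjoint by embedding them into a sum type, see verts below;
   a record value is a bipartite graph only if it satisfies bipartite_graph. *)
record ('a, 'b) bigraph =
  lclass :: "'a set"
  rclass :: "'b set"
  edges :: "('a \<times> 'b) set"

definition bipartite_graph :: "('a, 'b) bigraph \<Rightarrow> bool" where
  "bipartite_graph B \<longleftrightarrow>
     finite (lclass B) \<and> finite (rclass B) \<and> edges B \<subseteq> lclass B \<times> rclass B"

definition mir :: "('a, 'b) bigraph \<Rightarrow> ('a, 'b) bigraph" where
  "mir B = \<lparr>lclass = lclass B, rclass = rclass B, edges = lclass B \<times> rclass B - edges B\<rparr>"

definition verts :: "('a, 'b) bigraph \<Rightarrow> ('a + 'b) set" where
  "verts B = lclass B <+> rclass B"

definition adj :: "('a, 'b) bigraph \<Rightarrow> 'a + 'b \<Rightarrow> 'a + 'b \<Rightarrow> bool" where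
  "adj B u v \<longleftrightarrow>
     (\<exists>(x, y) \<in> edges B. u = Inl x \<and> v = Inr y \<or> u = Inr y \<and> v = Inl x)"

(* c lists the vertices of the cycle in cyclic order; the equivalence excludes chords.
   The description is intended for n \<ge> 3. *)
definition induced_cycle :: "('a, 'b) bigraph \<Rightarrow> nat \<Rightarrow> ('a + 'b) list \<Rightarrow> bool" where
  "induced_cycle B n c \<longleftrightarrow>
     length c = n \<and> distinct c \<and> set c \<subseteq> verts B \<and>
     (\<forall>i<n. \<forall>j<n. adj B (c ! i) (c ! j) \<longleftrightarrow> j = Suc i mod n \<or> i = Suc j mod n)"

definition chordal_bipartite :: "('a, 'b) bigraph \<Rightarrow> bool" where
  "chordal_bipartite B \<longleftrightarrow>
     bipartite_graph B \<and> \<not> (\<exists>k\<ge>3. \<exists>c. induced_cycle B (2 * k) c)"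

definition ACB :: "('a, 'b) bigraph \<Rightarrow> bool" where
  "ACB B \<longleftrightarrow> chordal_bipartite B \<and> chordal_bipartite (mir B)"

definition pairwise_incomparable :: "('v \<Rightarrow> 'w set) \<Rightarrow> 'v set \<Rightarrow> bool" where
  "pairwise_incomparable N S \<longleftrightarrow>
     (\<forall>u\<in>S. \<forall>v\<in>S. u \<noteq> v \<longrightarrow> \<not> N u \<subseteq> N v \<and> \<not> N v \<subseteq> N u)"

definition nabla_X :: "('a, 'b) bigraph \<Rightarrow> nat" where
  "nabla_X B =
     Max (card ` {S. S \<subseteq> lclass B \<and> pairwise_incomparable (\<lambda>x. {y. (x, y) \<in> edges B}) S})"

definition nabla_Y :: "('a, 'b) bigraph \<Rightarrow> nat" where
  "nabla_Y B =
     Max (card ` {S. S \<subseteq> rclass B \<and> pairwise_incomparable (\<lambda>y. {x. (x, y) \<in> edges B}) S})"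

(* The vertices x_i and y_j are represented by their indices i and j.
   The graph is only meant for k \<ge> 2, where the subtractions on nat do not truncate. *)
definition D :: "nat \<Rightarrow> (nat, nat) bigraph" where
  "D k =
     \<lparr>lclass = {1..3 * k - 4}, rclass = {1..3 * k - 4},
      edges = {(i, j). i \<in> {1..3 * k - 4} \<and> j \<in> {1..3 * k - 4} \<and>
                 \<bar>int i - int j\<bar> \<le> int k - 2 \<and> {i, j} \<inter> {k - 1..2 * k - 2} \<noteq> {}}\<rparr>"

end

theory Submission
  imports Defs
begin

text \<open>
  Call an index core if it lies in \<open>{k - 1..2 * k - 2}\<close>, low if it is smaller, high if larger.
  Chordal bipartiteness only uses that an induced cycle of length at least 6 is 2-regular and
  contains no 4-cycle. In \<open>D k\<close> all neighbourhoods are intervals; the leftmost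
  \<open>y\<close> of a cycle would then have two different immediate successors in the cycle. In the mirror,
  noncore vertices form a biclique and a core vertex has at most one core neighbour. If both
  sides of the cycle contain noncore vertices, then both contain at least two (a single one would
  be adjacent to the whole other side), which gives a 4-cycle; otherwise one side is entirely
  core and the other entirely noncore, and two low (or two high) vertices have nested
  neighbourhoods. For the antichains, the windows of the \<open>k\<close> core vertices are incomparable,
  while clamping indices to the core is injective on every antichain.
\<close>

section \<open>Two-regular bipartite relations without 4-cycles\<close>

text \<open>The cyclic order is forgotten: these are the nonempty finite disjoint unions of cycles
  of length at least 6 in the graph that \<open>R\<close> induces on \<open>P\<close> and
  \<open>Q\<close>. The conditions are symmetric in the two sides, so each fact about
  \<open>P\<close> also serves for \<open>Q\<close>.\<close>

definition two_regular_no_C4 :: "('a \<Rightarrow> 'b \<Rightarrow> bool) \<Rightarrow> 'a set \<Rightarrow> 'b set \<Rightarrow> bool" where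
  "two_regular_no_C4 R P Q \<longleftrightarrow> P \<noteq> {} \<and> Q \<noteq> {} \<and> finite P \<and> finite Q \<and>
     (\<forall>p\<in>P. \<exists>a b. a \<noteq> b \<and> {q \<in> Q. R p q} = {a, b}) \<and>
     (\<forall>q\<in>Q. \<exists>a b. a \<noteq> b \<and> {p \<in> P. R p q} = {a, b}) \<and>
     (\<forall>p\<in>P. \<forall>p'\<in>P. \<forall>q\<in>Q. \<forall>q'\<in>Q.
        p \<noteq> p' \<longrightarrow> q \<noteq> q' \<longrightarrow> \<not> (R p q \<and> R p q' \<and> R p' q \<and> R p' q'))"

lemma two_regular_no_C4D:
  assumes "two_regular_no_C4 R P Q" "p \<in> P" "p' \<in> P" "q \<in> Q" "q' \<in> Q"
    "R p q" "R p q'" "R p' q" "R p' q'"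
  shows "p = p' \<or> q = q'"
proof -
  have "\<forall>p\<in>P. \<forall>p'\<in>P. \<forall>q\<in>Q. \<forall>q'\<in>Q.
      p \<noteq> p' \<longrightarrow> q \<noteq> q' \<longrightarrow> \<not> (R p q \<and> R p q' \<and> R p' q \<and> R p' q')"
    using assms(1) unfolding two_regular_no_C4_def by (elim conjE)
  then show ?thesis using assms(2-) by blast
qed

lemma two_regular_no_C4_swap:
  assumes "two_regular_no_C4 R P Q"
  shows "two_regular_no_C4 (\<lambda>q p. R p q) Q P"
proof -
  have "\<forall>q\<in>Q. \<forall>q'\<in>Q. \<forall>p\<in>P. \<forall>p'\<in>P.
      q \<noteq> q' \<longrightarrow> p \<noteq> p' \<longrightarrow> \<not> (R p q \<and> R p' q \<and> R p q' \<and> R p' q')"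
    using two_regular_no_C4D[OF assms] by blast
  with assms show ?thesis unfolding two_regular_no_C4_def by (elim conjE, intro conjI)
qed

lemma two_regular_no_C4_right_nbrs:
  assumes "two_regular_no_C4 R P Q" "p \<in> P"
  obtains a b where "a \<noteq> b" "a \<in> Q" "b \<in> Q" "R p a" "R p b"
    "\<forall>q\<in>Q. R p q \<longrightarrow> q = a \<or> q = b"
proof -
  have "\<forall>p\<in>P. \<exists>a b. a \<noteq> b \<and> {q \<in> Q. R p q} = {a, b}"
    using assms(1) unfolding two_regular_no_C4_def by (elim conjE)
  then obtain a b where "a \<noteq> b" "{q \<in> Q. R p q} = {a, b}"
    using assms(2) by blast
  then show thesis by (intro that[of a b]) blast+
qed

lemma two_regular_no_C4_left_nbrs:
  assumes "two_regular_no_C4 R P Q" "q \<in> Q"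
  obtains a b where "a \<noteq> b" "a \<in> P" "b \<in> P" "R a q" "R b q"
    "\<forall>p\<in>P. R p q \<longrightarrow> p = a \<or> p = b"
  by (rule two_regular_no_C4_right_nbrs[OF two_regular_no_C4_swap[OF assms(1)] assms(2)])

lemma two_regular_no_C4_other_nbr:
  assumes "two_regular_no_C4 R P Q" "p \<in> P" "q \<in> Q" "R p q"
  obtains q' where "q' \<in> Q" "q' \<noteq> q" "R p q'"
    "\<forall>z\<in>Q. R p z \<longrightarrow> z = q \<or> z = q'"
proof -
  obtain a b where ab: "a \<noteq> b" "a \<in> Q" "b \<in> Q" "R p a" "R p b"
    and u: "\<forall>z\<in>Q. R p z \<longrightarrow> z = a \<or> z = b"
    by (rule two_regular_no_C4_right_nbrs[OF assms(1,2)]) (rule that)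
  consider "q = a" | "q = b" using u assms(3,4) by blast
  then show thesis
  proof cases
    case 1
    show thesis by (rule that[OF ab(3) _ ab(5)]) (use 1 ab(1) u in blast)+
  next
    case 2
    show thesis by (rule that[OF ab(2) _ ab(4)]) (use 2 ab(1) u in blast)+
  qed
qed

text \<open>The two neighbours of \<open>p\<close> would also be neighbours of \<open>p'\<close>,
  closing a 4-cycle if \<open>p\<close> and \<open>p'\<close> differed.\<close>

lemma two_regular_no_C4_nested:
  assumes T: "two_regular_no_C4 R P Q" and p: "p \<in> P" "p' \<in> P"
    and sub: "\<And>q. q \<in> Q \<Longrightarrow> R p q \<Longrightarrow> R p' q"
  shows "p = p'"
proof -
  obtain a b where ab: "a \<noteq> b" "a \<in> Q" "b \<in> Q" "R p a" "R p b"
    by (rule two_regular_no_C4_right_nbrs[OF T p(1)]) (rule that)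
  then show ?thesis using two_regular_no_C4D[OF T p ab(2-5)] sub by blast
qed

text \<open>Follow the path \<open>b\<close>, \<open>q\<close>, \<open>a\<close>, \<open>q'\<close>,
  \<open>c\<close>; its ends differ because \<open>c = b\<close> would close a 4-cycle.\<close>

lemma two_regular_no_C4_three:
  assumes "two_regular_no_C4 R P Q"
  obtains a b c where "a \<in> P" "b \<in> P" "c \<in> P" "a \<noteq> b" "a \<noteq> c" "b \<noteq> c"
proof -
  have "Q \<noteq> {}" using assms unfolding two_regular_no_C4_def by (elim conjE)
  then obtain q where q: "q \<in> Q" by blast
  obtain a b where ab: "a \<noteq> b" "a \<in> P" "b \<in> P" "R a q" "R b q"
    by (rule two_regular_no_C4_left_nbrs[OF assms q]) (rule that)
  obtain q' where q': "q' \<in> Q" "q' \<noteq> q" "R a q'"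
    by (rule two_regular_no_C4_other_nbr[OF assms ab(2) q ab(4)]) (rule that)
  obtain c where c: "c \<in> P" "c \<noteq> a" "R c q'"
    by (rule two_regular_no_C4_other_nbr[OF two_regular_no_C4_swap[OF assms] q'(1) ab(2) q'(3)]) (rule that)
  have "c \<noteq> b" using two_regular_no_C4D[OF assms ab(2,3) q q'(1)] ab q' c by blast
  then show thesis using that ab c by blast
qed

text \<open>A vertex has two neighbours, but the opposite side has at least three vertices.\<close>

lemma two_regular_no_C4_dominating:
  assumes T: "two_regular_no_C4 R P Q" and p: "p \<in> P" and dom: "\<And>q. q \<in> Q \<Longrightarrow> R p q"
  shows False
proof -
  obtain a b where "\<forall>q\<in>Q. R p q \<longrightarrow> q = a \<or> q = b"
    by (rule two_regular_no_C4_right_nbrs[OF T p]) (rule that)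
  then have Q: "q = a \<or> q = b" if "q \<in> Q" for q using that dom[OF that] by blast
  obtain c d e where "c \<in> Q" "d \<in> Q" "e \<in> Q" "c \<noteq> d" "c \<noteq> e" "d \<noteq> e"
    by (rule two_regular_no_C4_three[OF two_regular_no_C4_swap[OF T]])
  then show False using Q[of c] Q[of d] Q[of e] by metis
qed

section \<open>From induced cycles to two-regular relations\<close>

lemma Suc_mod_nat_eq: "i < m \<Longrightarrow> Suc i mod m = (if Suc i = m then 0 else Suc i)"
  by auto

lemma induced_cycle_nbrs:
  assumes "induced_cycle B m c" "3 \<le> m" "v \<in> set c"
  obtains u w where "u \<noteq> w" "{z \<in> set c. adj B v z} = {u, w}"
proof -
  have len: "length c = m" and dist: "distinct c"
    and adj: "\<And>i j. i < m \<Longrightarrow> j < m \<Longrightarrow>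
      adj B (c ! i) (c ! j) \<longleftrightarrow> j = Suc i mod m \<or> i = Suc j mod m"
    using assms(1) unfolding induced_cycle_def by auto
  obtain i where i: "i < m" "v = c ! i" using assms(3) len by (metis in_set_conv_nth)
  \<comment> \<open>The cyclic successor and predecessor of \<open>i\<close>, written without
    \<open>mod\<close> so that case splits and linear arithmetic suffice; they differ since
    \<open>m\<close> is at least 3.\<close>
  define s where "s = (if Suc i = m then 0 else Suc i)"
  define p where "p = (if i = 0 then m - 1 else i - 1)"
  have sp: "s < m" "p < m" "s \<noteq> p" using i assms(2) unfolding s_def p_def by (auto split: if_splits)
  have iff: "adj B v (c ! j) \<longleftrightarrow> j = s \<or> j = p" if "j < m" for j
    using adj[OF i(1) that] i that unfolding s_def p_def
    by (auto simp: Suc_mod_nat_eq split: if_splits)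
  show thesis
  proof (rule that[of "c ! s" "c ! p"])
    show "c ! s \<noteq> c ! p" using dist sp len by (simp add: nth_eq_iff_index_eq)
    show "{z \<in> set c. adj B v z} = {c ! s, c ! p}"
      using iff sp len by (auto simp: in_set_conv_nth)
  qed
qed

text \<open>A 4-cycle would return to its start after four successor steps, which is impossible once
  \<open>m\<close> is at least 5.\<close>

lemma induced_cycle_no_C4:
  assumes "induced_cycle B m c" "5 \<le> m" "{u, u', v, v'} \<subseteq> set c" "u \<noteq> u'" "v \<noteq> v'"
  shows "\<not> (adj B u v \<and> adj B u v' \<and> adj B u' v \<and> adj B u' v')"
proof -
  have len: "length c = m"
    and adj: "\<And>i j. i < m \<Longrightarrow> j < m \<Longrightarrow>
      adj B (c ! i) (c ! j) \<longleftrightarrow> j = Suc i mod m \<or> i = Suc j mod m"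
    using assms(1) unfolding induced_cycle_def by auto
  obtain a a' b b' where *: "a < m" "a' < m" "b < m" "b' < m"
    "u = c ! a" "u' = c ! a'" "v = c ! b" "v' = c ! b'"
    using assms(3) len by (auto simp: in_set_conv_nth)
  have ne: "a \<noteq> a'" "b \<noteq> b'" using assms(4,5) * by auto
  define s where "s i = (if Suc i = m then 0 else Suc i)" for i
  have adj_s: "adj B (c ! i) (c ! j) \<longleftrightarrow> j = s i \<or> i = s j" if "i < m" "j < m" for i j
    using adj[OF that] that unfolding s_def by (simp add: Suc_mod_nat_eq)
  have inj: "i = j" if "s i = s j" "i < m" "j < m" for i j
    using that unfolding s_def by (auto split: if_splits)
  have no4: "s (s (s (s i))) \<noteq> i" if "i < m" for i
    using that assms(2) unfolding s_def by (auto split: if_splits)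
  show ?thesis
  proof
    assume "adj B u v \<and> adj B u v' \<and> adj B u' v \<and> adj B u' v'"
    then have e: "b = s a \<or> a = s b" "b' = s a \<or> a = s b'" "b = s a' \<or> a' = s b"
      "b' = s a' \<or> a' = s b'" using * adj_s by auto
    \<comment> \<open>Equal orientations are excluded by injectivity, so the four vertices form an orbit of \<open>s\<close>.\<close>
    from e ne inj[of a a'] inj[of b b'] *(1-4)
    have "s (s (s (s a))) = a" by auto
    then show False using no4 *(1) by blast
  qed
qed

lemma adj_simps:
  "adj B (Inl x) (Inr y) \<longleftrightarrow> (x, y) \<in> edges B"
  "adj B (Inr y) (Inl x) \<longleftrightarrow> (x, y) \<in> edges B"
  "\<not> adj B (Inl x) (Inl x')"
  "\<not> adj B (Inr y) (Inr y')"
  unfolding adj_def by auto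

lemma induced_cycle_two_regular:
  assumes "induced_cycle B m c" "5 \<le> m"
  shows "two_regular_no_C4 (\<lambda>x y. (x, y) \<in> edges B) {x. Inl x \<in> set c} {y. Inr y \<in> set c}"
    (is "two_regular_no_C4 ?R ?P ?Q")
proof -
  have m: "3 \<le> m" using assms(2) by simp
  have P: "\<exists>a b. a \<noteq> b \<and> {y \<in> ?Q. ?R x y} = {a, b}" if "x \<in> ?P" for x
  proof -
    have "Inl x \<in> set c" using that by simp
    then obtain u w where uw: "u \<noteq> w" "{z \<in> set c. adj B (Inl x) z} = {u, w}"
      by (rule induced_cycle_nbrs[OF assms(1) m])
    then have "adj B (Inl x) u" "adj B (Inl x) w" by blast+
    \<comment> \<open>Edges only join different summands, so both cycle neighbours of an
      \<open>Inl\<close> vertex are \<open>Inr\<close> vertices.\<close>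
    then obtain a b where ab: "u = Inr a" "w = Inr b" by (cases u; cases w) (auto simp: adj_simps)
    have "y \<in> ?Q \<and> ?R x y \<longleftrightarrow> Inr y \<in> {u, w}" for y
      unfolding uw(2)[symmetric] by (simp add: adj_simps)
    then have "{y \<in> ?Q. ?R x y} = {a, b}" using ab by auto
    moreover have "a \<noteq> b" using uw(1) ab by simp
    ultimately show ?thesis by blast
  qed
  have Q: "\<exists>a b. a \<noteq> b \<and> {x \<in> ?P. ?R x y} = {a, b}" if "y \<in> ?Q" for y
  proof -
    have "Inr y \<in> set c" using that by simp
    then obtain u w where uw: "u \<noteq> w" "{z \<in> set c. adj B (Inr y) z} = {u, w}"
      by (rule induced_cycle_nbrs[OF assms(1) m])
    then have "adj B (Inr y) u" "adj B (Inr y) w" by blast+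
    then obtain a b where ab: "u = Inl a" "w = Inl b" by (cases u; cases w) (auto simp: adj_simps)
    have "x \<in> ?P \<and> ?R x y \<longleftrightarrow> Inl x \<in> {u, w}" for x
      unfolding uw(2)[symmetric] by (simp add: adj_simps)
    then have "{x \<in> ?P. ?R x y} = {a, b}" using ab by auto
    moreover have "a \<noteq> b" using uw(1) ab by simp
    ultimately show ?thesis by blast
  qed
  have "length c = m" using assms(1) unfolding induced_cycle_def by simp
  \<comment> \<open>Some vertex lies on the cycle, and its neighbours lie in the other class; hence
    both sides are nonempty.\<close>
  then have c0: "c ! 0 \<in> set c" using m by simp
  have PQ: "\<exists>y. y \<in> ?Q" if x: "x \<in> ?P" for x
  proof -
    obtain a b where "{y \<in> ?Q. ?R x y} = {a, b}" using P[OF x] by (elim exE conjE)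
    then have "a \<in> ?Q" by auto
    then show ?thesis ..
  qed
  have QP: "\<exists>x. x \<in> ?P" if y: "y \<in> ?Q" for y
  proof -
    obtain a b where "{x \<in> ?P. ?R x y} = {a, b}" using Q[OF y] by (elim exE conjE)
    then have "a \<in> ?P" by auto
    then show ?thesis ..
  qed
  have "(\<exists>x. x \<in> ?P) \<and> (\<exists>y. y \<in> ?Q)"
  proof (cases "c ! 0")
    case (Inl x)
    then have "x \<in> ?P" using c0 by simp
    then show ?thesis using PQ[of x] by (intro conjI exI[of _ x])
  next
    case (Inr y)
    then have "y \<in> ?Q" using c0 by simp
    then show ?thesis using QP[of y] by (intro conjI exI[of _ y])
  qed
  then have ne: "?P \<noteq> {}" "?Q \<noteq> {}" by auto
  have "finite (Inl -` set c)" "finite (Inr -` set c)" by (simp_all add: finite_vimageI)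
  then have fin: "finite ?P" "finite ?Q" unfolding vimage_def by simp_all
  have C4: "\<not> (?R x y \<and> ?R x y' \<and> ?R x' y \<and> ?R x' y')"
    if "x \<in> ?P" "x' \<in> ?P" "y \<in> ?Q" "y' \<in> ?Q" "x \<noteq> x'" "y \<noteq> y'" for x x' y y'
    using induced_cycle_no_C4[OF assms, of "Inl x" "Inl x'" "Inr y" "Inr y'"] that
    by (simp add: adj_simps)
  show ?thesis unfolding two_regular_no_C4_def
    by (intro conjI ballI impI ne fin P Q C4)
qed

lemma chordal_bipartiteI:
  assumes "bipartite_graph B"
    "\<And>P Q. P \<subseteq> lclass B \<Longrightarrow> Q \<subseteq> rclass B \<Longrightarrow>
       \<not> two_regular_no_C4 (\<lambda>x y. (x, y) \<in> edges B) P Q"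
  shows "chordal_bipartite B"
proof -
  have False if "n \<ge> 3" "induced_cycle B (2 * n) c" for n c
  proof -
    have "set c \<subseteq> verts B" using that(2) unfolding induced_cycle_def by simp
    then have "{x. Inl x \<in> set c} \<subseteq> lclass B" "{y. Inr y \<in> set c} \<subseteq> rclass B"
      unfolding verts_def by auto
    then show False using assms(2) induced_cycle_two_regular[OF that(2)] that(1) by simp
  qed
  then show ?thesis using assms(1) unfolding chordal_bipartite_def by blast
qed

section \<open>Interval neighbourhoods and chordality of \<open>D k\<close>\<close>

lemma convex_not_two_regular_no_C4:
  fixes Q :: "'b::linorder set"
  assumes "\<And>p a b c. R p a \<Longrightarrow> R p c \<Longrightarrow> a < b \<Longrightarrow> b < c \<Longrightarrow> R p b"
  shows "\<not> two_regular_no_C4 R P Q"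
proof
  assume T: "two_regular_no_C4 R P Q"
  define y where "y = Min Q"
  have fin: "finite Q" "Q \<noteq> {}" using T unfolding two_regular_no_C4_def by simp_all
  have y: "y \<in> Q" and le: "\<And>z. z \<in> Q \<Longrightarrow> y \<le> z" unfolding y_def using fin by auto
  obtain p p' where p: "p \<noteq> p'" "p \<in> P" "p' \<in> P" "R p y" "R p' y"
    by (rule two_regular_no_C4_left_nbrs[OF T y]) (rule that)
  obtain z where z: "z \<in> Q" "z \<noteq> y" "R p z" and zu: "\<forall>q\<in>Q. R p q \<longrightarrow> q = y \<or> q = z"
    by (rule two_regular_no_C4_other_nbr[OF T p(2) y p(4)]) (rule that)
  obtain z' where z': "z' \<in> Q" "z' \<noteq> y" "R p' z'"
    and zu': "\<forall>q\<in>Q. R p' q \<longrightarrow> q = y \<or> q = z'"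
    by (rule two_regular_no_C4_other_nbr[OF T p(3) y p(5)]) (rule that)
  \<comment> \<open>Otherwise \<open>p\<close>, \<open>y\<close>, \<open>p'\<close>,
    \<open>z\<close> would form a 4-cycle.\<close>
  have "z \<noteq> z'" using two_regular_no_C4D[OF T p(2,3) y z(1)] p z z' by blast
  moreover have "y < z" "y < z'" using le z z' by (auto simp: order_less_le)
  \<comment> \<open>The smaller of \<open>z\<close> and \<open>z'\<close> lies strictly between
    \<open>y\<close> and the larger one, so convexity makes it a third neighbour of \<open>p\<close>
    or \<open>p'\<close>.\<close>
  ultimately consider "y < z" "z < z'" | "y < z'" "z' < z" by (meson neqE)
  then show False
  proof cases
    case 1
    then have "R p' z" using assms[OF p(5) z'(3)] \<open>y < z\<close> by blast
    then show False using zu' z(1,2) \<open>z \<noteq> z'\<close> by blast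
  next
    case 2
    then have "R p z'" using assms[OF p(4) z(3)] by blast
    then show False using zu z'(1,2) \<open>z \<noteq> z'\<close> by blast
  qed
qed

context
  fixes k :: nat
  assumes k: "2 \<le> k"
begin

text \<open>The distance bound is restated additively over \<open>nat\<close>, so that later goals
  are linear arithmetic without absolute values or conversions to \<open>int\<close>.\<close>

lemma D_edge_iff:
  "(i, j) \<in> edges (D k) \<longleftrightarrow> i \<in> {1..3 * k - 4} \<and> j \<in> {1..3 * k - 4} \<and>
     i + 2 \<le> j + k \<and> j + 2 \<le> i + k \<and> (i \<in> {k - 1..2 * k - 2} \<or> j \<in> {k - 1..2 * k - 2})"
  using k unfolding D_def by auto

lemma bipartite_graph_D: "bipartite_graph (D k)"
  unfolding bipartite_graph_def D_def by auto

lemma chordal_bipartite_D: "chordal_bipartite (D k)"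
proof (rule chordal_bipartiteI[OF bipartite_graph_D], rule convex_not_two_regular_no_C4)
  fix p a b c
  assume "(p, a) \<in> edges (D k)" "(p, c) \<in> edges (D k)" "a < b" "b < c"
  then show "(p, b) \<in> edges (D k)" unfolding D_edge_iff by auto
qed

section \<open>The mirror of \<open>D k\<close>\<close>

lemma mir_D_edge_iff:
  "(i, j) \<in> edges (mir (D k)) \<longleftrightarrow> i \<in> {1..3 * k - 4} \<and> j \<in> {1..3 * k - 4} \<and>
     (j + k < i + 2 \<or> i + k < j + 2 \<or> i \<notin> {k - 1..2 * k - 2} \<and> j \<notin> {k - 1..2 * k - 2})"
proof -
  have "(i, j) \<in> edges (mir (D k)) \<longleftrightarrow>
      i \<in> {1..3 * k - 4} \<and> j \<in> {1..3 * k - 4} \<and> (i, j) \<notin> edges (D k)"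
    unfolding mir_def by (simp add: D_def)
  then show ?thesis unfolding D_edge_iff by auto
qed

lemma mir_D_sym: "(i, j) \<in> edges (mir (D k)) \<longleftrightarrow> (j, i) \<in> edges (mir (D k))"
  unfolding mir_D_edge_iff by auto

lemma mir_D_noncore:
  assumes "i \<in> {1..3 * k - 4}" "j \<in> {1..3 * k - 4}"
    "i \<notin> {k - 1..2 * k - 2}" "j \<notin> {k - 1..2 * k - 2}"
  shows "(i, j) \<in> edges (mir (D k))"
  using assms unfolding mir_D_edge_iff by blast

text \<open>Mirror adjacency with a core vertex requires distance at least \<open>k - 1\<close>,
  which is the diameter of the core. The only core indices that far apart are its two ends.\<close>

lemma mir_D_core_unique:
  assumes "(i, j) \<in> edges (mir (D k))" "(i, j') \<in> edges (mir (D k))"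
    "i \<in> {k - 1..2 * k - 2}" "j \<in> {k - 1..2 * k - 2}" "j' \<in> {k - 1..2 * k - 2}"
  shows "j = j'"
  using assms k unfolding mir_D_edge_iff by auto

abbreviation (input) mir_cycle :: "nat set \<Rightarrow> nat set \<Rightarrow> bool" where
  "mir_cycle \<equiv> two_regular_no_C4 (\<lambda>x y. (x, y) \<in> edges (mir (D k)))"

text \<open>Since the relation on indices is symmetric, exchanging the sides leaves it unchanged,
  and every result on \<open>P\<close> transfers to \<open>Q\<close>.\<close>

lemma mir_cycle_swap: "mir_cycle P Q \<Longrightarrow> mir_cycle Q P"
  using two_regular_no_C4_swap[of "\<lambda>x y. (x, y) \<in> edges (mir (D k))" P Q] mir_D_sym by simp

text \<open>At most one of the two neighbours of a core vertex is core.\<close>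

lemma mir_cycle_core_nbr:
  assumes "mir_cycle P Q" "q \<in> Q" "q \<in> {k - 1..2 * k - 2}"
  obtains p where "p \<in> P" "p \<notin> {k - 1..2 * k - 2}" "(p, q) \<in> edges (mir (D k))"
proof -
  obtain a b where ab: "a \<noteq> b" "a \<in> P" "b \<in> P"
    "(a, q) \<in> edges (mir (D k))" "(b, q) \<in> edges (mir (D k))"
    by (rule two_regular_no_C4_left_nbrs[OF assms(1,2)]) (rule that)
  have "(q, a) \<in> edges (mir (D k))" "(q, b) \<in> edges (mir (D k))" using ab mir_D_sym by blast+
  then have "a \<notin> {k - 1..2 * k - 2} \<or> b \<notin> {k - 1..2 * k - 2}"
    using mir_D_core_unique[of q a b] ab(1) assms(3) by blast
  then show thesis using that ab by blast
qed

text \<open>If \<open>p\<close> were the only noncore vertex of \<open>P\<close>, each core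
  \<open>q\<close> would have it as its noncore neighbour and each noncore \<open>q\<close> would
  see it through the biclique, so \<open>p\<close> would dominate \<open>Q\<close>.\<close>

lemma mir_cycle_two_noncore:
  assumes T: "mir_cycle P Q" and sub: "P \<subseteq> {1..3 * k - 4}" "Q \<subseteq> {1..3 * k - 4}"
    and p: "p \<in> P" "p \<notin> {k - 1..2 * k - 2}"
  obtains p' where "p' \<in> P" "p' \<notin> {k - 1..2 * k - 2}" "p' \<noteq> p"
proof -
  have "\<exists>p'\<in>P. p' \<notin> {k - 1..2 * k - 2} \<and> p' \<noteq> p"
  proof (rule ccontr)
    assume *: "\<not> (\<exists>p'\<in>P. p' \<notin> {k - 1..2 * k - 2} \<and> p' \<noteq> p)"
    have "(p, q) \<in> edges (mir (D k))" if q: "q \<in> Q" for q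
    proof (cases "q \<in> {k - 1..2 * k - 2}")
      case True
      obtain p' where "p' \<in> P" "p' \<notin> {k - 1..2 * k - 2}" "(p', q) \<in> edges (mir (D k))"
        by (rule mir_cycle_core_nbr[OF T q True]) (rule that)
      then show ?thesis using * by blast
    next
      case False
      then show ?thesis using mir_D_noncore[of p q] p sub q by blast
    qed
    then show False using two_regular_no_C4_dominating[OF T p(1)] by blast
  qed
  then show thesis using that by blast
qed

lemma mir_cycle_not_core:
  assumes T: "mir_cycle P Q" and core: "Q \<subseteq> {k - 1..2 * k - 2}"
  shows False
proof -
  \<comment> \<open>The two neighbours of \<open>p\<close> are both core, so \<open>p\<close> itself
    cannot be.\<close>
  have P: "p < k - 1 \<or> 2 * k - 2 < p" if p: "p \<in> P" for p
  proof -
    obtain a b where ab: "a \<noteq> b" "a \<in> Q" "b \<in> Q"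
      "(p, a) \<in> edges (mir (D k))" "(p, b) \<in> edges (mir (D k))"
      by (rule two_regular_no_C4_right_nbrs[OF T p]) (rule that)
    then have "p \<notin> {k - 1..2 * k - 2}" using mir_D_core_unique[of p a b] core by blast
    then show ?thesis by auto
  qed
  have range: "p \<in> {1..3 * k - 4}" if p: "p \<in> P" for p
  proof -
    obtain a where "(p, a) \<in> edges (mir (D k))"
      by (rule two_regular_no_C4_right_nbrs[OF T p]) (rule that)
    then show ?thesis unfolding mir_D_edge_iff by blast
  qed
  \<comment> \<open>Of two low indices, the one farther from the core is adjacent to every core
    vertex that the nearer one is adjacent to. High indices behave in the mirrored way.\<close>
  have low: "False" if "p \<in> P" "p' \<in> P" "p < p'" "p' < k - 1" for p p'
  proof -
    have "(p, q) \<in> edges (mir (D k))" if "q \<in> Q" "(p', q) \<in> edges (mir (D k))" for q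
      using that \<open>p < p'\<close> \<open>p' < k - 1\<close> core range[OF \<open>p \<in> P\<close>]
      unfolding mir_D_edge_iff by auto
    then show False using two_regular_no_C4_nested[OF T that(2,1)] that(3) by blast
  qed
  have high: "False" if "p \<in> P" "p' \<in> P" "p < p'" "2 * k - 2 < p" for p p'
  proof -
    have "(p', q) \<in> edges (mir (D k))" if "q \<in> Q" "(p, q) \<in> edges (mir (D k))" for q
      using that \<open>p < p'\<close> \<open>2 * k - 2 < p\<close> core range[OF \<open>p' \<in> P\<close>]
      unfolding mir_D_edge_iff by auto
    then show False using two_regular_no_C4_nested[OF T that(1,2)] that(3) by blast
  qed
  obtain a b c where "a \<in> P" "b \<in> P" "c \<in> P" "a \<noteq> b" "a \<noteq> c" "b \<noteq> c"
    by (rule two_regular_no_C4_three[OF T])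
  \<comment> \<open>Among three vertices that are low or high, two are of the same kind.\<close>
  then show False using P low high by (metis linorder_neqE_nat)
qed

lemma not_mir_cycle:
  assumes sub: "P \<subseteq> {1..3 * k - 4}" "Q \<subseteq> {1..3 * k - 4}"
  shows "\<not> mir_cycle P Q"
proof
  assume T: "mir_cycle P Q"
  note T' = mir_cycle_swap[OF T]
  obtain q where q: "q \<in> Q" "q \<notin> {k - 1..2 * k - 2}" using mir_cycle_not_core[OF T] by blast
  obtain p where p: "p \<in> P" "p \<notin> {k - 1..2 * k - 2}" using mir_cycle_not_core[OF T'] by blast
  obtain p' where p': "p' \<in> P" "p' \<notin> {k - 1..2 * k - 2}" "p' \<noteq> p"
    using mir_cycle_two_noncore[OF T sub p] .
  obtain q' where q': "q' \<in> Q" "q' \<notin> {k - 1..2 * k - 2}" "q' \<noteq> q"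
    using mir_cycle_two_noncore[OF T' sub(2,1) q] .
  have "p = p' \<or> q = q'"
    by (rule two_regular_no_C4D[OF T]) (use p p' q q' sub mir_D_noncore in blast)+
  then show False using p' q' by blast
qed

lemma chordal_bipartite_mir_D: "chordal_bipartite (mir (D k))"
proof (rule chordal_bipartiteI)
  show "bipartite_graph (mir (D k))"
    using bipartite_graph_D unfolding bipartite_graph_def mir_def by auto
  fix P Q :: "nat set"
  assume "P \<subseteq> lclass (mir (D k))" "Q \<subseteq> rclass (mir (D k))"
  then show "\<not> mir_cycle P Q" by (intro not_mir_cycle) (simp_all add: mir_def D_def)
qed

section \<open>Antichains of neighbourhoods\<close>

lemma card_incomparable_D_le:
  assumes S: "S \<subseteq> {1..3 * k - 4}"
    and inc: "pairwise_incomparable (\<lambda>x. {y. (x, y) \<in> edges (D k)}) S"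
  shows "card S \<le> k"
proof -
  \<comment> \<open>The nearest core index. Two indices share it only if both are at most
    \<open>k - 1\<close> or both at least \<open>2 * k - 2\<close>, and there neighbourhoods grow
    towards the core.\<close>
  define clamp where "clamp i = max (k - 1) (min i (2 * k - 2))" for i
  have neq: "clamp i \<noteq> clamp i'" if i: "i \<in> S" "i' \<in> S" "i < i'" for i i'
  proof
    assume "clamp i = clamp i'"
    then consider "i' \<le> k - 1" | "2 * k - 2 \<le> i"
      using i(3) k unfolding clamp_def by (auto simp: max_def min_def split: if_splits)
    then have "(\<forall>y. (i, y) \<in> edges (D k) \<longrightarrow> (i', y) \<in> edges (D k)) \<or>
        (\<forall>y. (i', y) \<in> edges (D k) \<longrightarrow> (i, y) \<in> edges (D k))"
    proof cases
      case 1
      then have "\<forall>y. (i, y) \<in> edges (D k) \<longrightarrow> (i', y) \<in> edges (D k)"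
        using i S unfolding D_edge_iff by auto
      then show ?thesis ..
    next
      case 2
      then have "\<forall>y. (i', y) \<in> edges (D k) \<longrightarrow> (i, y) \<in> edges (D k)"
        using i S unfolding D_edge_iff by auto
      then show ?thesis ..
    qed
    then have "{y. (i, y) \<in> edges (D k)} \<subseteq> {y. (i', y) \<in> edges (D k)} \<or>
        {y. (i', y) \<in> edges (D k)} \<subseteq> {y. (i, y) \<in> edges (D k)}" by (simp add: Collect_mono_iff)
    moreover have "i \<noteq> i'" using i(3) by simp
    ultimately show False
      using inc[unfolded pairwise_incomparable_def, rule_format, OF i(1,2)] by simp
  qed
  have "inj_on clamp S" by (rule linorder_inj_onI'[OF neq])
  moreover have "clamp ` S \<subseteq> {k - 1..2 * k - 2}" using k unfolding clamp_def by auto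
  ultimately have "card S \<le> card {k - 1..2 * k - 2}" by (intro card_inj_on_le) auto
  then show ?thesis using k by simp
qed

text \<open>The index range is just wide enough that no window of radius \<open>k - 2\<close> around
  a core index is cut off; different windows are therefore proper translates of each other.\<close>

lemma incomparable_core:
  "pairwise_incomparable (\<lambda>x. {y. (x, y) \<in> edges (D k)}) {k - 1..2 * k - 2}"
proof -
  have *: "\<not> {y. (u, y) \<in> edges (D k)} \<subseteq> {y. (v, y) \<in> edges (D k)} \<and>
      \<not> {y. (v, y) \<in> edges (D k)} \<subseteq> {y. (u, y) \<in> edges (D k)}"
    if "u \<in> {k - 1..2 * k - 2}" "v \<in> {k - 1..2 * k - 2}" "u < v" for u v
  proof -
    \<comment> \<open>The witnesses are the left end of the window of \<open>u\<close> and the right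
      end of the window of \<open>v\<close>.\<close>
    have "(u, u + 2 - k) \<in> edges (D k)" "(v, u + 2 - k) \<notin> edges (D k)"
      "(v, v + k - 2) \<in> edges (D k)" "(u, v + k - 2) \<notin> edges (D k)"
      using that k unfolding D_edge_iff by auto
    then show ?thesis by blast
  qed
  show ?thesis
    unfolding pairwise_incomparable_def
  proof (intro ballI impI)
    fix u v
    assume uv: "u \<in> {k - 1..2 * k - 2}" "v \<in> {k - 1..2 * k - 2}" "u \<noteq> v"
    then consider "u < v" | "v < u" by linarith
    then show "\<not> {y. (u, y) \<in> edges (D k)} \<subseteq> {y. (v, y) \<in> edges (D k)} \<and>
        \<not> {y. (v, y) \<in> edges (D k)} \<subseteq> {y. (u, y) \<in> edges (D k)}"
      by cases (use *[OF uv(1,2)] *[OF uv(2,1)] in simp_all)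
  qed
qed

lemma nabla_X_D: "nabla_X (D k) = k"
  unfolding nabla_X_def
proof (rule Max_eqI)
  let ?F = "{S. S \<subseteq> lclass (D k) \<and> pairwise_incomparable (\<lambda>x. {y. (x, y) \<in> edges (D k)}) S}"
  have l: "lclass (D k) = {1..3 * k - 4}" by (simp add: D_def)
  have "?F \<subseteq> Pow {1..3 * k - 4}" unfolding l by blast
  then have "finite ?F" by (rule finite_subset) simp
  then show "finite (card ` ?F)" by (rule finite_imageI)
  show "n \<le> k" if "n \<in> card ` ?F" for n using that card_incomparable_D_le unfolding l by blast
  \<comment> \<open>The core attains the bound; it lies within the index range because
    \<open>k\<close> is at least 2.\<close>
  have "{k - 1..2 * k - 2} \<in> ?F" using incomparable_core k unfolding l by auto
  moreover have "card {k - 1..2 * k - 2} = k" using k by simp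
  ultimately show "k \<in> card ` ?F" by (intro image_eqI[where x = "{k - 1..2 * k - 2}"]) simp_all
qed

text \<open>Edges of \<open>D k\<close> are symmetric in the indices and both classes have the same
  index set, so the value for the other class carries over.\<close>

lemma nabla_Y_D: "nabla_Y (D k) = k"
proof -
  have "(i, j) \<in> edges (D k) \<longleftrightarrow> (j, i) \<in> edges (D k)" for i j unfolding D_edge_iff by auto
  then have "{x. (x, y) \<in> edges (D k)} = {x. (y, x) \<in> edges (D k)}" for y by blast
  moreover have "rclass (D k) = lclass (D k)" by (simp add: D_def)
  ultimately show ?thesis using nabla_X_D unfolding nabla_X_def nabla_Y_def by simp
qed

end

theorem theorem3:
  fixes k :: nat
  assumes "k \<ge> 2"
  shows "ACB (D k) \<and> nabla_X (D k) = k \<and> nabla_Y (D k) = k"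
  using assms chordal_bipartite_D chordal_bipartite_mir_D nabla_X_D nabla_Y_D
  unfolding ACB_def by simp

end
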